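(* Let $(Q_k)_{k\ge0}$ be the Q-learning iterates and let $(Q_k^U)_{k\ge0}$ be the upper comparison system, i.e. the stochastic linear switching system $$Q_{k+1}^U-Q^*=A_{Q_k}(Q_k^U-Q^* )+\alpha w_k,\qquad Q_0^U-Q^*\in\mathbb R^{|\mathcal S||\mathcal A|},$$ driven by the same noise $w_k$ as the Q-learning iteration, with $A_{Q_k}$ determined by the Q-learning iterate $Q_k$ (all objects defined in the context). Suppose $Q_0^U-Q^*\ge Q_0-Q^*$, where $\ge$ is element-wise. Then $Q_k^U-Q^*\ge Q_k-Q^*$ (element-wise) for all $k\ge0$.
   Context: MDP: finite state space $\mathcal S=\{1,\dots,|\mathcal S|\}$, finite action space $\mathcal A=\{1,\dots,|\mathcal A|\}$, transition probabilities $P(s'|s,a)$, deterministic reward function $r(s,a,s')$, discount factor $\gamma\in[0,1)$. The MDP is assumed ergodic. $Q^*$ is the optimal Q-function (satisfying $Q^*(s,a)=\sum_{s'}P(s'|s,a)(r(s,a,s')+\gamma\max_{u}Q^*(s',u))$). Sampling: $p$ is a distribution on $\mathcal S$, $\beta(\cdot|s)$ a behavior policy, $d(s,a)=p(s)\beta(a|s)$. At each step $k$, independently of the past, $s_k\sim p$, $a_k\sim\beta(\cdot|s_k)$, $s_k'\sim P(\cdot|s_k,a_k)$, $r_k=r(s_k,a_k,s_k')$. Vector notation: functions on $\mathcal S\times\mathcal A$ are vectors in $\mathbb R^{|\mathcal S||\mathcal A|}$, stacked as $Q=(Q(\cdot,1);\dots;Q(\cdot,|\mathcal A|))$, so $Q(s,a)=(e_a\otimes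 e_s)^TQ$ with standard basis vectors $e_a\in\mathbb R^{|\mathcal A|}$, $e_s\in\mathbb R^{|\mathcal S|}$. $P\in\mathbb R^{|\mathcal S||\mathcal A|\times|\mathcal S|}$ is the matrix with entry $P(s'|s,a)$ in row $(s,a)$ and column $s'$; $R(s,a)=\mathbb E[r(s,a,s')|s,a]$; $D$ is the diagonal matrix with entries $d(s,a)$. For a deterministic policy $\pi$, $\Pi^\pi\in\mathbb R^{|\mathcal S|\times|\mathcal S||\mathcal A|}$ has $s$-th row $e_{\pi(s)}^T\otimes e_s^T$. The greedy policy is $\pi_Q(s)=\arg\max_{a}Q(s,a)$ (some fixed maximizer), and $\Pi_Q:=\Pi^{\pi_Q}$, so $(\Pi_QQ)(s)=\max_aQ(s,a)$. Q-learning with constant step-size $\alpha$: $Q_{k+1}(s_k,a_k)=Q_k(s_k,a_k)+\alpha\{r_k+\gamma\max_uQ_k(s_k',u)-Q_k(s_k,a_k)\}$, other entries unchanged. Equivalently $Q_{k+1}=Q_k+\alpha\{DR+\gamma DP\Pi_{Q_k}Q_k-DQ_k+w_k\}$, where $$w_k=(e_{a_k}\otimes e_{s_k})r_k+\gamma(e_{a_k}\otimes e_{s_k})e_{s_k'}^T\Pi_{Q_k}Q_k-(e_{a_k}\otimes e_{s_k})(e_{a_k}\otimes e_{s_k})^TQ_k-(DR+\gamma DP\Pi_{Q_k}Q_k-DQ_k).$$ For $Q\in\mathbb R^{|\mathcal S||\mathcal A|}$, $A_Q:=I+\alpha(\gamma DP\Pi_Q-D)$. Standing assumptions: $d(s,a)>0$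 for all $(s,a)$; constant $\alpha\in(0,1)$; $|r(s,a,s')|\le1$; $\|Q_0\|_\infty\le1$. *)

theory Defs
  imports "HOL-Probability.Probability"
begin

text \<open>
  States and actions are finite types. Functions on state-action pairs are vectors indexed by
  pairs (action, state), matching the stacking Q = (Q(.,1); ...; Q(.,|A|)), in which Q(s,a) is
  the entry selected by the Kronecker product of the a-th and s-th standard basis vectors.
  The rows of a matrix of type \<open>real ^ 'n ^ 'm\<close> are indexed by \<open>'m\<close>.
\<close>

type_synonym ('s, 'a) qvec = "real ^ ('a \<times> 's)"

definition kron :: "real ^ 'a \<Rightarrow> real ^ 's \<Rightarrow> ('s::finite, 'a::finite) qvec"
  where "kron x y = (\<chi> i. x $ fst i * y $ snd i)"

abbreviation basis_sa :: "'s \<Rightarrow> 'a \<Rightarrow> ('s::finite, 'a::finite) qvec"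
  where "basis_sa s a \<equiv> kron (axis a 1) (axis s 1)"

definition sa_dist :: "'s pmf \<Rightarrow> ('s \<Rightarrow> 'a pmf) \<Rightarrow> 's \<Rightarrow> 'a \<Rightarrow> real"
  where "sa_dist p \<beta> s a = pmf p s * pmf (\<beta> s) a"

definition sample_pmf ::
  "'s pmf \<Rightarrow> ('s \<Rightarrow> 'a pmf) \<Rightarrow> ('s \<Rightarrow> 'a \<Rightarrow> 's pmf) \<Rightarrow> ('s \<times> 'a \<times> 's) pmf"
  where "sample_pmf p \<beta> P =
    bind_pmf p (\<lambda>s. bind_pmf (\<beta> s) (\<lambda>a. map_pmf (\<lambda>s'. (s, a, s')) (P s a)))"

text \<open>
  Ergodicity of a finite MDP in the usual sense: under every deterministic stationary policy
  the induced chain consists of a single recurrent class, i.e. it is irreducible.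
  Aperiodicity is not demanded.
\<close>

definition ergodic_mdp :: "('s::finite \<Rightarrow> 'a::finite \<Rightarrow> 's pmf) \<Rightarrow> bool"
  where "ergodic_mdp P \<longleftrightarrow>
    (\<forall>\<pi>. \<forall>s s'. (s, s') \<in> {(x, y). pmf (P x (\<pi> x)) y > 0}\<^sup>*)"

text \<open>For a discount factor in [0,1) the optimal Q-function is the only solution.\<close>

definition bellman_optimality ::
  "('s \<Rightarrow> 'a \<Rightarrow> 's pmf) \<Rightarrow> ('s \<Rightarrow> 'a \<Rightarrow> 's \<Rightarrow> real) \<Rightarrow> real \<Rightarrow> ('s::finite, 'a::finite) qvec \<Rightarrow> bool"
  where "bellman_optimality P r \<gamma> Q \<longleftrightarrow>
    (\<forall>s a. Q $ (a, s) =
      (\<Sum>s'\<in>UNIV. pmf (P s a) s' * (r s a s' + \<gamma> * Max (range (\<lambda>u. Q $ (u, s'))))))"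

text \<open>An arbitrary but fixed choice of greedy policies, one for each Q.\<close>

definition greedy_selection :: "(('s::finite, 'a::finite) qvec \<Rightarrow> 's \<Rightarrow> 'a) \<Rightarrow> bool"
  where "greedy_selection g \<longleftrightarrow> (\<forall>Q s. is_arg_max (\<lambda>a. Q $ (a, s)) (\<lambda>_. True) (g Q s))"

definition P_mat :: "('s::finite \<Rightarrow> 'a::finite \<Rightarrow> 's pmf) \<Rightarrow> real ^ 's ^ ('a \<times> 's)"
  where "P_mat P = (\<chi> i. \<chi> s'. pmf (P (snd i) (fst i)) s')"

definition R_vec ::
  "('s \<Rightarrow> 'a \<Rightarrow> 's pmf) \<Rightarrow> ('s \<Rightarrow> 'a \<Rightarrow> 's \<Rightarrow> real) \<Rightarrow> ('s::finite, 'a::finite) qvec"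
  where "R_vec P r = (\<chi> i. measure_pmf.expectation (P (snd i) (fst i)) (r (snd i) (fst i)))"

definition D_mat ::
  "'s::finite pmf \<Rightarrow> ('s \<Rightarrow> 'a::finite pmf) \<Rightarrow> real ^ ('a \<times> 's) ^ ('a \<times> 's)"
  where "D_mat p \<beta> = (\<chi> i j. if i = j then sa_dist p \<beta> (snd i) (fst i) else 0)"

definition Pi_mat :: "('s::finite \<Rightarrow> 'a::finite) \<Rightarrow> real ^ ('a \<times> 's) ^ 's"
  where "Pi_mat \<pi> = (\<chi> s. basis_sa s (\<pi> s))"

text \<open>The matrix A of the switching system, for the greedy policy \<open>\<pi>\<close> of the current iterate.\<close>

definition A_mat ::
  "'s pmf \<Rightarrow> ('s \<Rightarrow> 'a pmf) \<Rightarrow> ('s \<Rightarrow> 'a \<Rightarrow> 's pmf) \<Rightarrow> real \<Rightarrow> real \<Rightarrow> ('s::finite \<Rightarrow> 'a::finite)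
    \<Rightarrow> real ^ ('a \<times> 's) ^ ('a \<times> 's)"
  where "A_mat p \<beta> P \<gamma> \<alpha> \<pi> =
    mat 1 + \<alpha> *\<^sub>R (\<gamma> *\<^sub>R (D_mat p \<beta> ** P_mat P ** Pi_mat \<pi>) - D_mat p \<beta>)"

definition q_learning_step ::
  "('s \<Rightarrow> 'a \<Rightarrow> 's \<Rightarrow> real) \<Rightarrow> real \<Rightarrow> real \<Rightarrow> 's \<times> 'a \<times> 's
    \<Rightarrow> ('s::finite, 'a::finite) qvec \<Rightarrow> ('s, 'a) qvec"
  where "q_learning_step r \<gamma> \<alpha> = (\<lambda>(s, a, s') Q. \<chi> i.
    if i = (a, s)
    then Q $ (a, s) + \<alpha> * (r s a s' + \<gamma> * Max (range (\<lambda>u. Q $ (u, s'))) - Q $ (a, s))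
    else Q $ i)"

definition q_noise ::
  "'s pmf \<Rightarrow> ('s \<Rightarrow> 'a pmf) \<Rightarrow> ('s \<Rightarrow> 'a \<Rightarrow> 's pmf) \<Rightarrow> ('s \<Rightarrow> 'a \<Rightarrow> 's \<Rightarrow> real) \<Rightarrow> real
    \<Rightarrow> (('s, 'a) qvec \<Rightarrow> 's \<Rightarrow> 'a) \<Rightarrow> 's \<times> 'a \<times> 's
    \<Rightarrow> ('s::finite, 'a::finite) qvec \<Rightarrow> ('s, 'a) qvec"
  where "q_noise p \<beta> P r \<gamma> g = (\<lambda>(s, a, s') Q.
    r s a s' *\<^sub>R basis_sa s a
    + (\<gamma> * (axis s' 1 \<bullet> (Pi_mat (g Q) *v Q))) *\<^sub>R basis_sa s a
    - (basis_sa s a \<bullet> Q) *\<^sub>R basis_sa s a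
    - (D_mat p \<beta> *v R_vec P r
       + \<gamma> *\<^sub>R ((D_mat p \<beta> ** P_mat P ** Pi_mat (g Q)) *v Q)
       - D_mat p \<beta> *v Q))"

end

theory Submission imports Defs begin

text \<open>
  The upper system and Q-learning share the noise \<open>w\<close> and the current greedy policy \<open>\<pi>\<close>, so both
  drop out when the two recursions are subtracted. Writing \<open>\<Pi>\<close> for the selection matrix of \<open>\<pi>\<close>,
  Q-learning moves by
  \<open>\<alpha> (D R + \<gamma> D P \<Pi> Q - D Q + w)\<close>, and subtraction gives the exact identity
  \<open>Q\<^sup>U' - Q' = A (Q\<^sup>U - Q) + \<alpha> (D Q* - (D R + \<gamma> D P \<Pi> Q*))\<close>
  with primes marking the next iterates.

  Both terms on the right preserve the ordering. The matrix \<open>A\<close> has only nonnegative entries: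
  its only negative contribution is \<open>- \<alpha> d\<close> on the diagonal, which the identity matrix absorbs
  because the step size and the sampling probability \<open>d\<close> are at most one
  (\<open>A_mat_mult_nonneg\<close>). The residual is nonnegative because \<open>\<pi>\<close>, greedy for \<open>Q\<close>, is in general
  suboptimal for \<open>Q*\<close>: evaluating \<open>Q*\<close> along \<open>\<pi>\<close> cannot exceed the maximum in the Bellman equation
  (\<open>bellman_dominates_policy\<close>). Induction on the time index finishes the argument, separately for
  each sample path.
\<close>

lemma Pi_mat_mult_nth:
  fixes \<pi> :: "'s::finite \<Rightarrow> 'a::finite" and x :: "('s, 'a) qvec"
  shows "(Pi_mat \<pi> *v x) $ s = x $ (\<pi> s, s)"
proof -
  have "(Pi_mat \<pi> *v x) $ s = (\<Sum>j\<in>UNIV. if j = (\<pi> s, s) then x $ j else 0)"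
    unfolding matrix_vector_mult_def Pi_mat_def kron_def
    by (auto simp: axis_def prod_eq_iff intro!: sum.cong)
  then show ?thesis by simp
qed

lemma P_mat_mult_nth:
  "(P_mat P *v v) $ (a, s) = (\<Sum>s'\<in>UNIV. pmf (P s a) s' * v $ s')"
  by (simp add: matrix_vector_mult_def P_mat_def)

lemma D_mat_mult_nth:
  "(D_mat p \<beta> *v x) $ (a, s) = sa_dist p \<beta> s a * x $ (a, s)"
  by (simp add: matrix_vector_mult_def D_mat_def if_distrib [of "\<lambda>c. c * _"] cong: if_cong)

lemma DP_Pi_mult_nth:
  fixes x :: "('s::finite, 'a::finite) qvec"
  shows "((D_mat p \<beta> ** P_mat P ** Pi_mat \<pi>) *v x) $ (a, s)
    = sa_dist p \<beta> s a * (\<Sum>s'\<in>UNIV. pmf (P s a) s' * x $ (\<pi> s', s'))"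
  by (simp add: matrix_vector_mul_assoc [symmetric] D_mat_mult_nth P_mat_mult_nth Pi_mat_mult_nth)

lemma R_vec_nth:
  fixes P :: "'s::finite \<Rightarrow> 'a::finite \<Rightarrow> 's pmf"
  shows "R_vec P r $ (a, s) = (\<Sum>s'\<in>UNIV. pmf (P s a) s' * r s a s')"
  by (simp add: R_vec_def integral_measure_pmf_real [where A = UNIV] mult.commute)

lemma A_mat_mult:
  "A_mat p \<beta> P \<gamma> \<alpha> \<pi> *v x
    = x + \<alpha> *\<^sub>R (\<gamma> *\<^sub>R ((D_mat p \<beta> ** P_mat P ** Pi_mat \<pi>) *v x) - D_mat p \<beta> *v x)"
  by (simp add: A_mat_def matrix_vector_mult_add_rdistrib matrix_vector_mult_diff_rdistrib
      scaleR_matrix_vector_assoc [symmetric])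

lemma sa_dist_nonneg: "0 \<le> sa_dist p \<beta> s a"
  by (simp add: sa_dist_def)

lemma sa_dist_le_1: "sa_dist p \<beta> s a \<le> 1"
  by (simp add: sa_dist_def pmf_le_1 mult_le_one)

text \<open>
  At \<open>(a, s)\<close> the product equals
  \<open>(1 - \<alpha> d) x(a, s) + \<alpha> \<gamma> d \<Sum>s'. P(s' | s, a) x(\<pi> s', s')\<close> with \<open>d\<close> the probability of sampling
  that pair, a nonnegative combination since \<open>\<alpha> d \<le> 1\<close>.
\<close>

lemma A_mat_mult_nonneg:
  fixes x :: "('s::finite, 'a::finite) qvec"
  assumes "0 \<le> \<gamma>" "0 \<le> \<alpha>" "\<alpha> \<le> 1" "0 \<le> x"
  shows "0 \<le> A_mat p \<beta> P \<gamma> \<alpha> \<pi> *v x"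
  unfolding less_eq_vec_def
proof
  fix i :: "'a \<times> 's"
  obtain a s where i: "i = (a, s)" by (cases i)
  let ?d = "sa_dist p \<beta> s a"
  let ?S = "\<Sum>s'\<in>UNIV. pmf (P s a) s' * x $ (\<pi> s', s')"
  have x: "0 \<le> x $ j" for j
    using \<open>0 \<le> x\<close> unfolding less_eq_vec_def zero_index by blast
  have "(A_mat p \<beta> P \<gamma> \<alpha> \<pi> *v x) $ (a, s) = (1 - \<alpha> * ?d) * x $ (a, s) + \<alpha> * (\<gamma> * (?d * ?S))"
    by (simp add: A_mat_mult DP_Pi_mult_nth D_mat_mult_nth algebra_simps)
  moreover have "\<alpha> * ?d \<le> 1"
    using assms by (intro mult_le_one sa_dist_nonneg sa_dist_le_1)
  moreover have "0 \<le> ?S"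
    by (intro sum_nonneg mult_nonneg_nonneg x) simp
  ultimately show "0 $ i \<le> (A_mat p \<beta> P \<gamma> \<alpha> \<pi> *v x) $ i"
    using assms x sa_dist_nonneg [of p \<beta> s a] by (simp add: i)
qed

text \<open>
  Replacing the maximum in the Bellman optimality equation by the action of an arbitrary policy can
  only decrease its right-hand side, because \<open>\<gamma>\<close> and the probabilities are nonnegative.
\<close>

lemma bellman_dominates_policy:
  fixes P :: "'s::finite \<Rightarrow> 'a::finite \<Rightarrow> 's pmf"
  assumes "bellman_optimality P r \<gamma> Q" "0 \<le> \<gamma>"
  shows "D_mat p \<beta> *v R_vec P r + \<gamma> *\<^sub>R ((D_mat p \<beta> ** P_mat P ** Pi_mat \<pi>) *v Q)
    \<le> D_mat p \<beta> *v Q"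
  unfolding less_eq_vec_def
proof
  fix i :: "'a \<times> 's"
  obtain a s where i: "i = (a, s)" by (cases i)
  have "(\<Sum>s'\<in>UNIV. pmf (P s a) s' * (r s a s' + \<gamma> * Q $ (\<pi> s', s')))
      \<le> (\<Sum>s'\<in>UNIV. pmf (P s a) s' * (r s a s' + \<gamma> * Max (range (\<lambda>u. Q $ (u, s')))))"
    using \<open>0 \<le> \<gamma>\<close> by (intro sum_mono mult_left_mono add_left_mono Max_ge) auto
  also have "\<dots> = Q $ (a, s)"
    using assms(1) unfolding bellman_optimality_def by metis
  finally have "sa_dist p \<beta> s a * (\<Sum>s'\<in>UNIV. pmf (P s a) s' * (r s a s' + \<gamma> * Q $ (\<pi> s', s')))
      \<le> sa_dist p \<beta> s a * Q $ (a, s)"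
    by (rule mult_left_mono [OF _ sa_dist_nonneg])
  then show "(D_mat p \<beta> *v R_vec P r
      + \<gamma> *\<^sub>R ((D_mat p \<beta> ** P_mat P ** Pi_mat \<pi>) *v Q)) $ i \<le> (D_mat p \<beta> *v Q) $ i"
    by (simp add: i DP_Pi_mult_nth D_mat_mult_nth R_vec_nth distrib_left sum.distrib
        sum_distrib_left mult.left_commute)
qed

lemma greedy_selection_attains_Max:
  fixes g :: "('s::finite, 'a::finite) qvec \<Rightarrow> 's \<Rightarrow> 'a"
  assumes "greedy_selection g"
  shows "Max (range (\<lambda>u. Q $ (u, s))) = Q $ (g Q s, s)"
  using assms
  by (intro Max_eqI) (auto simp: greedy_selection_def is_arg_max_linorder)

text \<open>
  The update of the sampled entry, split into its mean and the centred noise. The mean terms inside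
  the noise cancel those of the drift, so this is an identity for every sample and not merely one in
  expectation. Greediness identifies the value selected inside the noise with the maximum in the
  update.
\<close>

lemma q_learning_step_eq_drift_plus_noise:
  fixes Q :: "('s::finite, 'a::finite) qvec"
  assumes "greedy_selection g"
  shows "q_learning_step r \<gamma> \<alpha> z Q = Q + \<alpha> *\<^sub>R
    (D_mat p \<beta> *v R_vec P r + \<gamma> *\<^sub>R ((D_mat p \<beta> ** P_mat P ** Pi_mat (g Q)) *v Q)
      - D_mat p \<beta> *v Q + q_noise p \<beta> P r \<gamma> g z Q)"
proof -
  obtain s a s' where z: "z = (s, a, s')" by (cases z)
  have basis_nth: "basis_sa s a $ i = (if i = (a, s) then 1 else 0)" for i
    by (auto simp: kron_def axis_def prod_eq_iff)
  then have "basis_sa s a = axis (a, s) 1"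
    by (simp add: vec_eq_iff axis_def)
  then have inner_basis: "basis_sa s a \<bullet> Q = Q $ (a, s)"
    by (simp add: inner_axis')
  have "axis s' 1 \<bullet> (Pi_mat (g Q) *v Q) = Max (range (\<lambda>u. Q $ (u, s')))"
    by (simp add: inner_axis' Pi_mat_mult_nth greedy_selection_attains_Max [OF assms])
  then show ?thesis
    by (simp add: z vec_eq_iff q_learning_step_def q_noise_def inner_basis basis_nth algebra_simps)
qed

theorem proposition4:
  fixes P :: "'s::finite \<Rightarrow> 'a::finite \<Rightarrow> 's pmf"
    and r :: "'s \<Rightarrow> 'a \<Rightarrow> 's \<Rightarrow> real"
    and \<gamma> \<alpha> :: real
    and p :: "'s pmf"
    and \<beta> :: "'s \<Rightarrow> 'a pmf"
    and g :: "('s, 'a) qvec \<Rightarrow> 's \<Rightarrow> 'a"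
    and M :: "'w measure"
    and s s' :: "nat \<Rightarrow> 'w \<Rightarrow> 's"
    and a :: "nat \<Rightarrow> 'w \<Rightarrow> 'a"
    and Qstar Q0 QU0 :: "('s, 'a) qvec"
    and Q QU :: "nat \<Rightarrow> 'w \<Rightarrow> ('s, 'a) qvec"
  assumes discount: "0 \<le> \<gamma>" "\<gamma> < 1"
    and step_size: "0 < \<alpha>" "\<alpha> < 1"
    and ergodic: "ergodic_mdp P"
    and reward_bound: "\<And>x u y. \<bar>r x u y\<bar> \<le> 1"
    and dist_pos: "\<And>x u. sa_dist p \<beta> x u > 0"
    and optimal: "bellman_optimality P r \<gamma> Qstar"
    and greedy: "greedy_selection g"
    and prob: "prob_space M"
    and samples_indep: "prob_space.indep_vars M (\<lambda>_. count_space UNIV)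
      (\<lambda>k \<omega>. (s k \<omega>, a k \<omega>, s' k \<omega>)) UNIV"
    and samples_distr: "\<And>k. distr M (count_space UNIV) (\<lambda>\<omega>. (s k \<omega>, a k \<omega>, s' k \<omega>))
      = measure_pmf (sample_pmf p \<beta> P)"
    and Q0_bound: "infnorm Q0 \<le> 1"
    and Q_init: "\<And>\<omega>. \<omega> \<in> space M \<Longrightarrow> Q 0 \<omega> = Q0"
    and Q_step: "\<And>k \<omega>. \<omega> \<in> space M \<Longrightarrow>
      Q (Suc k) \<omega> = q_learning_step r \<gamma> \<alpha> (s k \<omega>, a k \<omega>, s' k \<omega>) (Q k \<omega>)"
    and QU_init: "\<And>\<omega>. \<omega> \<in> space M \<Longrightarrow> QU 0 \<omega> = QU0"
    and QU_step: "\<And>k \<omega>. \<omega> \<in> space M \<Longrightarrow>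
      QU (Suc k) \<omega> - Qstar = A_mat p \<beta> P \<gamma> \<alpha> (g (Q k \<omega>)) *v (QU k \<omega> - Qstar)
        + \<alpha> *\<^sub>R q_noise p \<beta> P r \<gamma> g (s k \<omega>, a k \<omega>, s' k \<omega>) (Q k \<omega>)"
    and init_order: "QU0 - Qstar \<ge> Q0 - Qstar"
  shows "\<forall>k. \<forall>\<omega>\<in>space M. QU k \<omega> - Qstar \<ge> Q k \<omega> - Qstar"
proof (intro allI ballI)
  fix k \<omega>
  assume \<omega>: "\<omega> \<in> space M"
  show "QU k \<omega> - Qstar \<ge> Q k \<omega> - Qstar"
  proof (induction k)
    case 0
    show ?case
      using init_order by (simp add: Q_init [OF \<omega>] QU_init [OF \<omega>])
  next
    case (Suc k)
    let ?A = "A_mat p \<beta> P \<gamma> \<alpha> (g (Q k \<omega>))"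
    let ?DP\<Pi> = "D_mat p \<beta> ** P_mat P ** Pi_mat (g (Q k \<omega>))"
    let ?residual = "D_mat p \<beta> *v Qstar - (D_mat p \<beta> *v R_vec P r + \<gamma> *\<^sub>R (?DP\<Pi> *v Qstar))"
    \<comment> \<open>The residual at \<open>Qstar\<close> is what remains because the upper system applies its matrix to the
        error relative to \<open>Qstar\<close>, whereas the Q-learning drift is evaluated at the iterate itself.\<close>
    have "(QU (Suc k) \<omega> - Qstar) - (Q (Suc k) \<omega> - Qstar)
        = ?A *v (QU k \<omega> - Q k \<omega>) + \<alpha> *\<^sub>R ?residual"
      unfolding QU_step [OF \<omega>] Q_step [OF \<omega>]
        q_learning_step_eq_drift_plus_noise [OF greedy, where p = p and \<beta> = \<beta> and P = P]
      by (simp add: A_mat_mult algebra_simps)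
    moreover have "0 \<le> ?A *v (QU k \<omega> - Q k \<omega>)"
      using discount step_size Suc.IH by (intro A_mat_mult_nonneg) auto
    moreover have "0 \<le> \<alpha> *\<^sub>R ?residual"
      using bellman_dominates_policy [OF optimal discount(1)] step_size
      by (simp add: less_eq_vec_def)
    ultimately show ?case
      by (metis add_nonneg_nonneg diff_ge_0_iff_ge)
  qed
qed

end
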